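(* For all nonnegative integers $n$ and $m$, $$\det\left(\binom{i+j+m}{i-j+m}\right)_{i,j=0}^{n-1}=\prod_{j=1}^{n-1}\frac{j!}{(2j)!}\prod_{j=1}^{n-1}\frac{(2m+2j)!}{(2m+j)!}=\det\left(C_{n+i+j}\right)_{i,j=0}^{m-1},$$ where $C_\ell=\frac{1}{\ell+1}\binom{2\ell}{\ell}$ are the Catalan numbers.
   Context: Binomial coefficients $\binom{a}{b}$ with $a\ge0$ vanish if $b<0$ or $b>a$. Empty products and determinants of $0\times0$ matrices equal $1$. *)

theory Defs
  imports Complex_Main "Jordan_Normal_Form.Determinant"
begin

text \<open>
  Binomial coefficients with a natural number on top and an integer below. They vanish for
  a negative lower index; for a lower index above the upper one this is already the behaviour
  of the library's \<^const>\<open>binomial\<close>.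
\<close>

definition int_binomial :: "nat \<Rightarrow> int \<Rightarrow> nat" where
  "int_binomial a b = (if b < 0 then 0 else a choose nat b)"

definition catalan :: "nat \<Rightarrow> rat" where
  "catalan l = 1 / (of_nat l + 1) * of_nat ((2 * l) choose l)"

end

theory Submission
  imports Defs
begin

text \<open>
  Up to the factor $1/(2j)!$, the entry of the first matrix is a monic polynomial of degree $j$ in
  $(i+m)(i+m+1)$, so the first determinant is a Vandermonde determinant. The Catalan Hankel matrix
  becomes upper triangular after multiplication by an explicit lower triangular matrix
  (essentially the coefficients of the orthogonal polynomials of the moment sequence): the
  entries of the product are higher-order finite differences of polynomials of too small degree,
  and those on the diagonal are finite differences of a rational function with a single pole.
\<close>

section \<open>Alternating binomial sums\<close>

text \<open>Pascal's rule: an alternating sum of order \<open>n + 1\<close> is one of order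
  \<open>n\<close> applied to the first difference. All inductions on the order of the difference
  rest on this.\<close>

lemma alternating_binomial_sum_Suc:
  fixes f :: "nat \<Rightarrow> 'a::comm_ring_1"
  shows "(\<Sum>k\<le>Suc n. (-1) ^ k * of_nat (Suc n choose k) * f k)
       = (\<Sum>k\<le>n. (-1) ^ k * of_nat (n choose k) * (f k - f (Suc k)))"
proof -
  have "(\<Sum>k\<le>Suc n. (-1) ^ k * of_nat (Suc n choose k) * f k)
      = f 0 + (\<Sum>k\<le>n. (-1) ^ Suc k * of_nat (Suc n choose Suc k) * f (Suc k))"
    by (simp only: sum.atMost_Suc_shift) simp
  also have "\<dots> = (f 0 + (\<Sum>k\<le>n. (-1) ^ Suc k * of_nat (n choose Suc k) * f (Suc k)))
      - (\<Sum>k\<le>n. (-1) ^ k * of_nat (n choose k) * f (Suc k))"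
    by (simp add: algebra_simps sum.distrib sum_negf sum_subtractf)
  also have "f 0 + (\<Sum>k\<le>n. (-1) ^ Suc k * of_nat (n choose Suc k) * f (Suc k))
      = (\<Sum>k\<le>Suc n. (-1) ^ k * of_nat (n choose k) * f k)"
    by (simp only: sum.atMost_Suc_shift) simp
  also have "\<dots> = (\<Sum>k\<le>n. (-1) ^ k * of_nat (n choose k) * f k)"
    by (simp add: binomial_eq_0)
  finally show ?thesis
    by (simp add: right_diff_distrib sum_subtractf)
qed

text \<open>Shifting the argument by 1 preserves both the degree and the leading coefficient, so the
  top terms cancel.\<close>

lemma degree_diff_shift:
  fixes p :: "'a::idom poly"
  assumes "degree p \<le> Suc n"
  shows "degree (p - pcompose p [:1, 1:]) \<le> n"
proof -
  have "coeff (p - pcompose p [:1, 1:]) k = 0" if "k > n" for k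
  proof (cases "k = degree p")
    case True
    have "coeff (pcompose p [:1, 1:]) (degree p) = lead_coeff (pcompose p [:1, 1:])"
      by (simp add: degree_pcompose)
    also have "\<dots> = lead_coeff p"
      by (subst lead_coeff_comp) auto
    finally show ?thesis
      using True by simp
  next
    case False
    then have "k > degree p"
      using assms that by simp
    then show ?thesis
      by (simp add: coeff_eq_0 degree_pcompose)
  qed
  then show ?thesis
    by (intro degree_le) auto
qed

text \<open>Each difference lowers the degree, so \<open>n\<close> of them annihilate
  \<open>p\<close>.\<close>

lemma alternating_binomial_sum_poly_eq_0:
  fixes p :: "'a::idom poly"
  assumes "degree p < n"
  shows "(\<Sum>k\<le>n. (-1) ^ k * of_nat (n choose k) * poly p (of_nat k)) = 0"
  using assms
proof (induction n arbitrary: p)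
  case (Suc n)
  let ?q = "p - pcompose p [:1, 1:]"
  have "(\<Sum>k\<le>Suc n. (-1) ^ k * of_nat (Suc n choose k) * poly p (of_nat k))
      = (\<Sum>k\<le>n. (-1) ^ k * of_nat (n choose k) * poly ?q (of_nat k))"
    by (subst alternating_binomial_sum_Suc) (simp add: poly_pcompose)
  \<comment> \<open>For \<open>n = 0\<close> the induction hypothesis would ask for a degree below
    0; there \<open>p\<close> is constant and its difference is already zero.\<close>
  also have "\<dots> = 0"
  proof (cases n)
    case 0
    with Suc.prems have "degree p = 0"
      by simp
    then obtain a where "p = [:a:]"
      by (rule degree_eq_zeroE)
    then show ?thesis
      by simp
  next
    case (Suc l)
    with Suc.prems show ?thesis
      using degree_diff_shift[of p l] by (intro Suc.IH) simp
  qed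
  finally show ?case .
qed simp

text \<open>Both sides are the Beta integral of x^d (1 - x)^n over [0, 1]. The induction avoids
  integration: the first difference of the reciprocals pairs \<open>d\<close> with
  \<open>Suc d\<close>, hence \<open>d\<close> is arbitrary.\<close>

lemma alternating_binomial_sum_reciprocal:
  "(\<Sum>k\<le>n. (-1) ^ k * of_nat (n choose k) / (of_nat (k + d + 1) :: 'a::field_char_0))
     = fact n * fact d / fact (n + d + 1)"
proof (induction n arbitrary: d)
  case (Suc n)
  have "(\<Sum>k\<le>Suc n. (-1) ^ k * of_nat (Suc n choose k) / (of_nat (k + d + 1) :: 'a))
      = (\<Sum>k\<le>n. (-1) ^ k * of_nat (n choose k)
            * (1 / (of_nat (k + d + 1) :: 'a) - 1 / of_nat (k + Suc d + 1)))"
    using alternating_binomial_sum_Suc[of n "\<lambda>k. 1 / (of_nat (k + d + 1) :: 'a)"] by simp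
  also have "\<dots> = fact n * fact d / fact (n + d + 1)
      - fact n * fact (Suc d) / fact (n + Suc d + 1)"
    unfolding Suc.IH[symmetric] by (simp add: right_diff_distrib sum_subtractf)
  also have "\<dots> = fact (Suc n) * fact d / fact (Suc n + d + 1)"
  proof -
    have "(of_nat (n + d + 2) :: 'a) \<noteq> 0"
      by (subst of_nat_eq_0_iff) simp
    moreover have "(fact (n + Suc d + 1) :: 'a) = of_nat (n + d + 2) * fact (n + d + 1)"
      by (simp add: algebra_simps)
    ultimately show ?thesis
      by (simp add: divide_simps del: of_nat_add fact_Suc) (simp add: algebra_simps)
  qed
  finally show ?case .
qed (simp add: divide_simps)

text \<open>Divide \<open>p\<close> by x + d + 1: the quotient has too small a degree to contribute,
  and the remainder, the value of \<open>p\<close> at the pole, multiplies the reciprocal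
  sum.\<close>

lemma alternating_binomial_sum_poly_over_linear:
  fixes p :: "'a::field_char_0 poly"
  assumes "degree p \<le> n"
  shows "(\<Sum>k\<le>n. (-1) ^ k * of_nat (n choose k) * (poly p (of_nat k) / of_nat (k + d + 1)))
     = poly p (- of_nat (d + 1)) * (fact n * fact d / fact (n + d + 1))"
proof -
  define c :: 'a where "c = - of_nat (d + 1)"
  define q where "q = synthetic_div p c"
  have p: "poly p x = (x - c) * poly q x + poly p c" for x
    using arg_cong[OF synthetic_div_correct'[of c p], of "\<lambda>r. poly r x"]
    by (simp add: q_def algebra_simps)
  have quot: "poly p (of_nat k) / of_nat (k + d + 1)
      = poly q (of_nat k) + poly p c / of_nat (k + d + 1)" for k
  proof -
    have "(of_nat (k + d + 1) :: 'a) \<noteq> 0"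
      by (subst of_nat_eq_0_iff) simp
    moreover have "of_nat k - c = of_nat (k + d + 1)"
      by (simp add: c_def)
    ultimately show ?thesis
      by (subst p) (simp add: add_divide_distrib del: of_nat_add)
  qed
  \<comment> \<open>Division lowers the degree strictly except for constants, whose quotient is 0;
    this is why \<open>n = 0\<close> is separate.\<close>
  have "(\<Sum>k\<le>n. (-1) ^ k * of_nat (n choose k) * poly q (of_nat k)) = 0"
  proof (cases "n = 0")
    case True
    with assms have "q = 0"
      by (simp add: q_def synthetic_div_eq_0_iff)
    then show ?thesis
      by simp
  next
    case False
    with assms show ?thesis
      by (intro alternating_binomial_sum_poly_eq_0) (simp add: q_def degree_synthetic_div)
  qed
  then have "(\<Sum>k\<le>n. (-1) ^ k * of_nat (n choose k) * (poly p (of_nat k) / of_nat (k + d + 1)))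
      = poly p c * (\<Sum>k\<le>n. (-1) ^ k * of_nat (n choose k) / of_nat (k + d + 1))"
    unfolding quot by (simp add: distrib_left sum.distrib sum_distrib_left mult_ac del: of_nat_add)
  then show ?thesis
    unfolding alternating_binomial_sum_reciprocal c_def .
qed

section \<open>Determinants by triangularization\<close>

lemma det_upper_triangular_prod:
  assumes "A \<in> carrier_mat n n" and "\<And>i j. j < i \<Longrightarrow> i < n \<Longrightarrow> A $$ (i, j) = 0"
  shows "det A = (\<Prod>i<n. A $$ (i, i))"
proof -
  have "det A = prod_list (diag_mat A)"
    using assms by (intro det_upper_triangular) auto
  then show ?thesis
    using assms(1) by (simp add: prod_list_diag_prod atLeast0LessThan)
qed

lemma det_lower_triangular_prod:
  assumes "A \<in> carrier_mat n n" and "\<And>i j. i < j \<Longrightarrow> j < n \<Longrightarrow> A $$ (i, j) = 0"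
  shows "det A = (\<Prod>i<n. A $$ (i, i))"
proof -
  have "det A = prod_list (diag_mat A)"
    using assms by (intro det_lower_triangular) auto
  then show ?thesis
    using assms(1) by (simp add: prod_list_diag_prod atLeast0LessThan)
qed

lemma index_mult_mat_sum:
  assumes "A \<in> carrier_mat n n" "B \<in> carrier_mat n n" "i < n" "j < n"
  shows "(A * B) $$ (i, j) = (\<Sum>k<n. A $$ (i, k) * B $$ (k, j))"
  using assms by (simp add: scalar_prod_def atLeast0LessThan)

text \<open>Subtracting \<open>coeff p j\<close> times the monic Newton polynomial of degree
  \<open>j\<close> lowers the degree bound. The top coefficient is recorded because it becomes a
  diagonal entry of the triangular factor.\<close>

lemma newton_expansion:
  fixes y :: "nat \<Rightarrow> 'a::idom"
  assumes "degree p \<le> j"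
  shows "\<exists>c. p = (\<Sum>k\<le>j. smult (c k) (\<Prod>l<k. [:- y l, 1:])) \<and> c j = coeff p j"
  using assms
proof (induction j arbitrary: p)
  case 0
  then obtain a where "p = [:a:]"
    by (auto elim: degree_eq_zeroE)
  then show ?case
    by (intro exI[of _ "\<lambda>_. a"]) simp
next
  case (Suc j)
  define N where "N = (\<Prod>l<Suc j. [:- y l, 1:])"
  have deg: "degree N = Suc j"
    unfolding N_def by (subst degree_prod_eq_sum_degree) auto
  have "lead_coeff N = 1"
    unfolding N_def lead_coeff_prod by simp
  then have lead: "coeff N (Suc j) = 1"
    by (simp add: deg)
  define q where "q = p - smult (coeff p (Suc j)) N"
  have "coeff q k = 0" if "k > j" for k
  proof (cases "k = Suc j")
    case True
    then show ?thesis
      by (simp add: q_def lead)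
  next
    case False
    with that Suc.prems show ?thesis
      by (simp add: q_def coeff_eq_0 deg)
  qed
  then have "degree q \<le> j"
    by (intro degree_le) auto
  from Suc.IH[OF this] obtain c where c: "q = (\<Sum>k\<le>j. smult (c k) (\<Prod>l<k. [:- y l, 1:]))"
    by blast
  have "(\<Sum>k\<le>j. smult ((c(Suc j := coeff p (Suc j))) k) (\<Prod>l<k. [:- y l, 1:]))
      = (\<Sum>k\<le>j. smult (c k) (\<Prod>l<k. [:- y l, 1:]))"
    by (intro sum.cong) auto
  then have "p = (\<Sum>k\<le>Suc j. smult ((c(Suc j := coeff p (Suc j))) k) (\<Prod>l<k. [:- y l, 1:]))"
    using c[unfolded q_def N_def] by (simp add: algebra_simps del: prod.lessThan_Suc)
  then show ?case
    by (intro exI[of _ "c(Suc j := coeff p (Suc j))"]) simp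
qed

text \<open>Newton interpolation is the LU factorization of the Vandermonde matrix.\<close>

lemma det_poly_vandermonde:
  fixes p :: "nat \<Rightarrow> 'a::idom poly"
  assumes "\<And>j. degree (p j) \<le> j"
  shows "det (mat n n (\<lambda>(i, j). poly (p j) (y i)))
       = (\<Prod>j<n. coeff (p j) j) * (\<Prod>j<n. \<Prod>l<j. y j - y l)"
proof -
  from newton_expansion[OF assms, of _ y] obtain c where
    c: "\<And>j. p j = (\<Sum>k\<le>j. smult (c j k) (\<Prod>l<k. [:- y l, 1:])) \<and> c j j = coeff (p j) j"
    by metis
  define L where "L = mat n n (\<lambda>(i, k). \<Prod>l<k. y i - y l)"
  define U where "U = mat n n (\<lambda>(k, j). if k \<le> j then c j k else 0)"
  have carrier: "L \<in> carrier_mat n n" "U \<in> carrier_mat n n"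
    by (simp_all add: L_def U_def)
  have "mat n n (\<lambda>(i, j). poly (p j) (y i)) = L * U"
  proof (rule eq_matI)
    fix i j
    assume "i < dim_row (L * U)" "j < dim_col (L * U)"
    then have ij: "i < n" "j < n"
      using carrier by auto
    have "(L * U) $$ (i, j) = (\<Sum>k<n. (\<Prod>l<k. y i - y l) * (if k \<le> j then c j k else 0))"
      using ij by (subst index_mult_mat_sum[OF carrier]) (simp_all add: L_def U_def)
    also have "\<dots> = (\<Sum>k\<le>j. c j k * (\<Prod>l<k. y i - y l))"
      using ij by (intro sum.mono_neutral_cong_right) auto
    also have "\<dots> = poly (p j) (y i)"
      by (subst conjunct1[OF c[of j]]) (simp add: poly_sum poly_prod)
    finally show "mat n n (\<lambda>(i, j). poly (p j) (y i)) $$ (i, j) = (L * U) $$ (i, j)"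
      using ij by simp
  qed (use carrier in auto)
  \<comment> \<open>Above the diagonal, where i < k, the product contains the zero factor with l =
    i.\<close>
  moreover have "det L = (\<Prod>j<n. \<Prod>l<j. y j - y l)"
    by (subst det_lower_triangular_prod[OF carrier(1)]) (auto simp: L_def)
  moreover have "det U = (\<Prod>j<n. coeff (p j) j)"
    by (subst det_upper_triangular_prod[OF carrier(2)]) (auto simp: U_def c)
  ultimately show ?thesis
    by (simp add: det_mult[OF carrier])
qed

section \<open>The determinant of binomial coefficients\<close>

text \<open>Symmetry of binomial coefficients makes the lower index independent of the row. If j > i
  + m, both sides vanish: the left index is negative, and 2j exceeds i + m + j.\<close>

lemma int_binomial_eq: "int_binomial (i + j + m) (int i - int j + int m) = (i + m + j) choose (2 * j)"
proof (cases "j \<le> i + m")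
  case True
  then have "int_binomial (i + j + m) (int i - int j + int m) = (i + j + m) choose (i + m - j)"
    by (auto simp: int_binomial_def nat_diff_distrib intro: arg_cong[where f = "binomial _"])
  also have "\<dots> = (i + j + m) choose (i + j + m - (i + m - j))"
    by (rule binomial_symmetric) simp
  also have "i + j + m - (i + m - j) = 2 * j"
    using True by simp
  finally show ?thesis
    by (simp add: add_ac)
qed (simp add: int_binomial_def binomial_eq_0)

text \<open>The left side is the product of the 2j consecutive numbers from x - j + 1 to x + j;
  pairing them as (x - k)(x + k + 1) = x(x + 1) - k(k + 1) gives the right side.\<close>

lemma fact_mult_binomial_double:
  "fact (2 * j) * (of_nat ((x + j) choose (2 * j)) :: rat)
     = (\<Prod>k<j. of_nat x * of_nat (x + 1) - of_nat k * of_nat (k + 1))"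
proof (induction j)
  case (Suc j)
  define a :: rat where "a = of_nat (x + j)"
  \<comment> \<open>Generalized binomials keep \<open>a - of_nat (2 * j)\<close> a genuine
    subtraction, also when x < j.\<close>
  have "(a + 1 gchoose Suc (Suc (2 * j))) * of_nat (2 * j + 2) = (a + 1) * (a gchoose Suc (2 * j))"
    using gbinomial_absorption[of "Suc (2 * j)" "a + 1"] by (simp add: mult_ac)
  moreover have "(a gchoose Suc (2 * j)) * of_nat (2 * j + 1) = (a - of_nat (2 * j)) * (a gchoose (2 * j))"
    using gbinomial_mult_1[of a "2 * j"] by (simp add: algebra_simps)
  ultimately have "(a + 1 gchoose Suc (Suc (2 * j))) * of_nat (2 * j + 2) * of_nat (2 * j + 1)
      = (a + 1) * (a - of_nat (2 * j)) * (a gchoose (2 * j))"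
    by (metis (no_types, lifting) mult.assoc)
  moreover have "fact (2 * Suc j) = (of_nat (2 * j + 2) * of_nat (2 * j + 1) * fact (2 * j) :: rat)"
    by (simp add: algebra_simps)
  moreover have "(of_nat ((x + Suc j) choose (2 * Suc j)) :: rat) = a + 1 gchoose Suc (Suc (2 * j))"
    by (simp add: a_def binomial_gbinomial add_ac del: binomial_Suc_Suc)
  ultimately have "fact (2 * Suc j) * (of_nat ((x + Suc j) choose (2 * Suc j)) :: rat)
      = (a + 1) * (a - of_nat (2 * j)) * (fact (2 * j) * (a gchoose (2 * j)))"
    by (simp add: mult_ac)
  also have "a gchoose (2 * j) = of_nat ((x + j) choose (2 * j))"
    by (simp add: a_def binomial_gbinomial)
  also have "(a + 1) * (a - of_nat (2 * j)) = of_nat x * of_nat (x + 1) - of_nat j * of_nat (j + 1)"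
    by (simp add: a_def algebra_simps)
  finally show ?case
    unfolding Suc.IH prod.lessThan_Suc by (simp only: mult.commute)
qed simp

lemma fact_ratio_prod:
  assumes "c \<le> i"
  shows "fact (x + i) / fact (x + c) = (\<Prod>l = c..<i. (of_nat (x + l + 1) :: 'a::field_char_0))"
  using assms
proof (induction i rule: dec_induct)
  case (step k)
  have "fact (x + Suc k) = of_nat (x + k + 1) * (fact (x + k) :: 'a)"
    by (simp add: algebra_simps)
  then have "fact (x + Suc k) / fact (x + c) = fact (x + k) / fact (x + c) * (of_nat (x + k + 1) :: 'a)"
    by (simp add: mult.commute del: of_nat_add fact_Suc)
  with step show ?case
    by (simp only: prod.atLeastLessThan_Suc)
qed simp

text \<open>Each difference of nodes factors as (j - l)(2m + j + l + 1).\<close>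

lemma prod_node_differences:
  "(\<Prod>l<j. of_nat (j + m) * of_nat (j + m + 1) - of_nat (l + m) * of_nat (l + m + 1) :: rat)
     = fact j * (fact (2 * m + 2 * j) / fact (2 * m + j))"
proof -
  have "(\<Prod>l<j. of_nat (j + m) * of_nat (j + m + 1) - of_nat (l + m) * of_nat (l + m + 1) :: rat)
      = (\<Prod>l<j. of_nat (j - l) * of_nat (2 * m + j + l + 1))"
    by (intro prod.cong) (auto simp: of_nat_diff algebra_simps)
  also have "\<dots> = (\<Prod>l<j. of_nat (j - l)) * (\<Prod>l<j. of_nat (2 * m + j + l + 1))"
    by (rule prod.distrib)
  also have "(\<Prod>l<j. of_nat (j - l) :: rat) = fact j"
  proof -
    have "(\<Prod>l<j. of_nat (j - l) :: rat) = (\<Prod>l<j. of_nat (Suc (j - Suc l)))"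
      by (intro prod.cong) auto
    also have "\<dots> = (\<Prod>l<j. of_nat (Suc l))"
      by (rule prod.nat_diff_reindex)
    also have "\<dots> = fact j"
      by (induction j) auto
    finally show ?thesis .
  qed
  also have "(\<Prod>l<j. of_nat (2 * m + j + l + 1) :: rat) = fact (2 * m + 2 * j) / fact (2 * m + j)"
    using fact_ratio_prod[of 0 j "2 * m + j", where 'a = rat]
    by (simp only: atLeast0LessThan add_0_right mult_2 add.assoc)
  finally show ?thesis .
qed

lemma det_binomial:
  "det (mat n n (\<lambda>(i, j). (of_nat ((i + m + j) choose (2 * j)) :: rat)))
     = (\<Prod>j<n. fact j / fact (2 * j)) * (\<Prod>j<n. fact (2 * m + 2 * j) / fact (2 * m + j))"
proof -
  define y :: "nat \<Rightarrow> rat" where "y i = of_nat (i + m) * of_nat (i + m + 1)" for i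
  define q :: "nat \<Rightarrow> rat poly" where "q j = (\<Prod>k<j. [:- (of_nat k * of_nat (k + 1)), 1:])" for j
  define p where "p j = smult (1 / fact (2 * j)) (q j)" for j
  have deg: "degree (q j) = j" for j
    unfolding q_def by (subst degree_prod_eq_sum_degree) auto
  have "lead_coeff (q j) = 1" for j
    unfolding q_def lead_coeff_prod by simp
  then have lead: "coeff (p j) j = 1 / fact (2 * j)" for j
    by (simp add: p_def deg)
  have "poly (p j) (y i) = of_nat ((i + m + j) choose (2 * j))" for i j
    using fact_mult_binomial_double[of j "i + m"]
    by (simp add: p_def q_def y_def poly_prod divide_simps mult_ac)
  then have "det (mat n n (\<lambda>(i, j). (of_nat ((i + m + j) choose (2 * j)) :: rat)))
      = (\<Prod>j<n. 1 / fact (2 * j)) * (\<Prod>j<n. \<Prod>l<j. y j - y l)"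
    using det_poly_vandermonde[of p n y] by (simp add: lead) (simp add: p_def deg)
  also have "(\<Prod>j<n. \<Prod>l<j. y j - y l)
      = (\<Prod>j<n. fact j * (fact (2 * m + 2 * j) / fact (2 * m + j)))"
    unfolding y_def prod_node_differences ..
  finally show ?thesis
    by (simp add: prod.distrib prod_dividef)
qed

section \<open>The Hankel determinant of Catalan numbers\<close>

lemma catalan_fact: "catalan l = fact (2 * l) / (fact l * fact (l + 1))"
proof -
  have "(of_nat l + 1 :: rat) \<noteq> 0"
    by (metis of_nat_Suc of_nat_neq_0 add.commute)
  then show ?thesis
    by (simp add: catalan_def binomial_fact mult_2[symmetric] divide_simps add_ac)
qed

text \<open>Raising x by 1 multiplies (2x)!/x! by 4x + 2. Thus a quotient of factorials becomes a
  polynomial in x of degree \<open>j\<close>.\<close>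

lemma fact_double_ratio:
  "fact (2 * (x + j)) * fact x / (fact (2 * x) * fact (x + j)) = (\<Prod>l<j. (of_nat (4 * x + 4 * l + 2) :: rat))"
proof (induction j)
  case (Suc j)
  have nz: "(of_nat (x + j + 1) :: rat) \<noteq> 0"
    by (subst of_nat_eq_0_iff) simp
  have "fact (2 * (x + Suc j)) = of_nat (4 * x + 4 * j + 2) * of_nat (x + j + 1) * (fact (2 * (x + j)) :: rat)"
    by (simp add: algebra_simps)
  moreover have "fact (x + Suc j) = of_nat (x + j + 1) * (fact (x + j) :: rat)"
    by (simp add: algebra_simps)
  ultimately have "fact (2 * (x + Suc j)) * fact x / (fact (2 * x) * fact (x + Suc j))
      = of_nat (4 * x + 4 * j + 2) * (fact (2 * (x + j)) * fact x / (fact (2 * x) * fact (x + j)) :: rat)"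
    using nz by (simp only: divide_simps fact_nonzero) simp
  then show ?case
    unfolding Suc.IH prod.lessThan_Suc by (simp only: mult.commute)
qed simp

text \<open>Row \<open>i\<close> is proportional to the coefficients of the Jacobi polynomial of
  degree \<open>i\<close> on [0, 4] with weight x^(n - 1/2) (4 - x)^(1/2), whose moments are
  proportional to the Catalan numbers from index \<open>n\<close> on.\<close>

definition catalan_lower :: "nat \<Rightarrow> nat \<Rightarrow> nat \<Rightarrow> rat" where
  "catalan_lower n i k
     = (-1) ^ k * of_nat (i choose k) * (fact (n + k + i) * fact (n + k) / fact (2 * (n + k)))"

text \<open>Isolates the function of \<open>k\<close> to be differenced \<open>i\<close> times: a
  polynomial of degree \<open>j\<close> times a factorial ratio that is polynomial for j < i and
  1/(n + k + i + 1) for j = i.\<close>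

lemma catalan_lower_mult_catalan:
  "catalan_lower n i k * catalan (n + k + j)
     = (-1) ^ k * of_nat (i choose k) * ((\<Prod>l<j. of_nat (4 * (n + k) + 4 * l + 2))
         * (fact (n + k + i) / fact (n + k + j + 1)))"
  unfolding catalan_lower_def catalan_fact fact_double_ratio[symmetric]
  by (simp add: mult_ac del: fact_Suc)

text \<open>The differenced function is a polynomial of degree j + (i - j - 1) = i - 1.\<close>

lemma catalan_lower_sum_eq_0:
  assumes "j < i"
  shows "(\<Sum>k\<le>i. catalan_lower n i k * catalan (n + k + j)) = 0"
proof -
  define p :: "rat poly" where
    "p = (\<Prod>l<j. [:of_nat (4 * n + 4 * l + 2), 4:]) * (\<Prod>l = j + 1..<i. [:of_nat (n + l + 1), 1:])"
  have "degree p = j + (i - (j + 1))"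
    unfolding p_def
    by (subst degree_mult_eq, force, force, (subst degree_prod_eq_sum_degree, force)+) simp
  then have "degree p < i"
    using assms by simp
  moreover have "poly p (of_nat k) = (\<Prod>l<j. of_nat (4 * (n + k) + 4 * l + 2))
         * (fact (n + k + i) / fact (n + k + j + 1))" for k
    using assms fact_ratio_prod[of "j + 1" i "n + k", where 'a = rat]
    by (simp add: p_def poly_prod algebra_simps)
  ultimately show ?thesis
    using alternating_binomial_sum_poly_eq_0[of p i]
    by (simp only: catalan_lower_mult_catalan)
qed

text \<open>Holds since (l + 1)(4l + 6) = (2l + 2)(2l + 3).\<close>

lemma fact_mult_prod_odd: "fact i * (\<Prod>l<i. of_nat (4 * l + 6)) = (fact (2 * i + 1) :: rat)"
proof (induction i)
  case (Suc i)
  have "fact (2 * Suc i + 1) = of_nat (4 * i + 6) * (of_nat (Suc i) * (fact (2 * i + 1) :: rat))"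
    by (simp add: algebra_simps)
  also have "\<dots> = fact (Suc i) * (\<Prod>l<Suc i. of_nat (4 * l + 6))"
    unfolding Suc.IH[symmetric] prod.lessThan_Suc fact_Suc by (simp only: mult_ac)
  finally show ?case ..
qed simp

text \<open>On the diagonal a simple pole at k = -(n + i + 1) survives, so the sum is governed by
  the value of the numerator there.\<close>

lemma catalan_lower_sum_diag:
  "(\<Sum>k\<le>i. catalan_lower n i k * catalan (n + k + i))
     = (-1) ^ i * (fact (2 * i + 1) * fact (n + i) / fact (n + 2 * i + 1))"
proof -
  define p :: "rat poly" where "p = (\<Prod>l<i. [:of_nat (4 * n + 4 * l + 2), 4:])"
  have deg: "degree p \<le> i"
    unfolding p_def by (subst degree_prod_eq_sum_degree) auto
  have "poly p (of_nat k) / of_nat (k + (n + i) + 1) = (\<Prod>l<i. of_nat (4 * (n + k) + 4 * l + 2))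
         * (fact (n + k + i) / fact (n + k + i + 1))" for k
  proof -
    have "fact (n + k + i + 1) = of_nat (k + (n + i) + 1) * (fact (n + k + i) :: rat)"
      by (simp add: algebra_simps)
    moreover have "poly p (of_nat k) = (\<Prod>l<i. of_nat (4 * (n + k) + 4 * l + 2))"
      by (simp add: p_def poly_prod algebra_simps)
    ultimately show ?thesis
      by (simp del: of_nat_add fact_Suc)
  qed
  then have "(\<Sum>k\<le>i. catalan_lower n i k * catalan (n + k + i))
      = poly p (- of_nat (n + i + 1)) * (fact i * fact (n + i) / fact (i + (n + i) + 1))"
    using alternating_binomial_sum_poly_over_linear[OF deg, of "n + i"]
    by (simp only: catalan_lower_mult_catalan)
  \<comment> \<open>At the pole, 4n + 4l + 2 - 4(n + i + 1) = -(4(i - l - 1) + 6); reversing the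
    order of the factors then removes the subtraction.\<close>
  also have "poly p (- of_nat (n + i + 1)) = (\<Prod>l<i. - of_nat (4 * (i - Suc l) + 6))"
    unfolding p_def poly_prod by (intro prod.cong) (auto simp: of_nat_diff algebra_simps)
  also have "\<dots> = (\<Prod>l<i. - of_nat (4 * l + 6))"
    by (rule prod.nat_diff_reindex)
  also have "\<dots> = (-1) ^ i * (\<Prod>l<i. of_nat (4 * l + 6))"
    by (induction i) (simp_all add: algebra_simps)
  also have "\<dots> * (fact i * fact (n + i) / fact (i + (n + i) + 1))
      = (-1) ^ i * (fact i * (\<Prod>l<i. of_nat (4 * l + 6))) * fact (n + i) / fact (i + (n + i) + 1)"
    by (simp add: mult_ac)
  also have "i + (n + i) + 1 = n + 2 * i + 1"
    by simp
  finally show ?thesis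
    unfolding fact_mult_prod_odd by (simp only: times_divide_eq_right mult.assoc)
qed

lemma det_catalan:
  "det (mat m m (\<lambda>(i, j). catalan (n + i + j)))
     = (\<Prod>i<m. fact (2 * i + 1) * fact (2 * n + 2 * i) / (fact (n + 2 * i + 1) * fact (n + 2 * i)))"
proof -
  define H where "H = mat m m (\<lambda>(i, j). catalan (n + i + j))"
  define W where "W = mat m m (\<lambda>(i, k). catalan_lower n i k)"
  have carrier: "W \<in> carrier_mat m m" "H \<in> carrier_mat m m"
    by (simp_all add: W_def H_def)
  have WH: "(W * H) $$ (i, j) = (\<Sum>k\<le>i. catalan_lower n i k * catalan (n + k + j))"
    if "i < m" "j < m" for i j
  proof -
    have "(W * H) $$ (i, j) = (\<Sum>k<m. catalan_lower n i k * catalan (n + k + j))"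
      using that by (subst index_mult_mat_sum[OF carrier]) (simp_all add: W_def H_def)
    \<comment> \<open>The factor \<open>i choose k\<close> is zero beyond k = i.\<close>
    also have "\<dots> = (\<Sum>k\<le>i. catalan_lower n i k * catalan (n + k + j))"
      using that by (intro sum.mono_neutral_right) (auto simp: catalan_lower_def)
    finally show ?thesis .
  qed
  have "det (W * H) = (\<Prod>i<m. (W * H) $$ (i, i))"
    using carrier by (intro det_upper_triangular_prod) (auto simp: WH catalan_lower_sum_eq_0 simp del: index_mult_mat)
  also have "\<dots> = (\<Prod>i<m. (-1) ^ i * (fact (2 * i + 1) * fact (n + i) / fact (n + 2 * i + 1)))"
    by (intro prod.cong) (simp_all only: lessThan_iff WH catalan_lower_sum_diag)
  finally have "det W * det H = \<dots>"
    by (simp add: det_mult[OF carrier])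
  moreover have "det W = (\<Prod>i<m. (-1) ^ i * (fact (n + 2 * i) * fact (n + i) / fact (2 * n + 2 * i)))"
    using carrier(1)
    by (subst det_lower_triangular_prod[of _ m]) (auto simp: W_def catalan_lower_def mult_ac mult_2 mult_2_right add_ac intro!: prod.cong)
  \<comment> \<open>The diagonal entries are factorial quotients up to sign, so dividing by
    \<open>det W\<close> is legitimate.\<close>
  moreover from this have "det W \<noteq> 0"
    by simp
  ultimately have "det H = (\<Prod>i<m. (-1) ^ i * (fact (2 * i + 1) * fact (n + i) / fact (n + 2 * i + 1)))
      / (\<Prod>i<m. (-1) ^ i * (fact (n + 2 * i) * fact (n + i) / fact (2 * n + 2 * i)))"
    by (metis nonzero_mult_div_cancel_left)
  also have "\<dots> = (\<Prod>i<m. fact (2 * i + 1) * fact (2 * n + 2 * i) / (fact (n + 2 * i + 1) * fact (n + 2 * i)))"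
    unfolding prod_dividef[symmetric] by (intro prod.cong) simp_all
  finally show ?thesis
    by (simp only: H_def)
qed

section \<open>Comparison of the two products\<close>

text \<open>Raising \<open>m\<close> by 1 contributes exactly the factor with index \<open>m\<close>
  of the Hankel product; this drives the induction on \<open>m\<close> below.\<close>

lemma prod_fact_ratio_Suc:
  "(\<Prod>j<n. fact (2 * Suc m + 2 * j) / fact (2 * Suc m + j) :: 'a::field_char_0)
     = (\<Prod>j<n. fact (2 * m + 2 * j) / fact (2 * m + j))
       * (fact (2 * m + 1) * fact (2 * n + 2 * m) / (fact (n + 2 * m + 1) * fact (n + 2 * m)))"
proof (induction n)
  case (Suc n)
  have e: "fact (2 * Suc n + 2 * m) = (fact (2 * Suc m + 2 * n) :: 'a)"
    "fact (2 * n + 2 * m) = (fact (2 * m + 2 * n) :: 'a)"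
    "fact (n + 2 * m) = (fact (2 * m + n) :: 'a)"
    "fact (Suc n + 2 * m) = (fact (n + 2 * m + 1) :: 'a)"
    "fact (Suc n + 2 * m + 1) = (fact (2 * Suc m + n) :: 'a)"
    by (simp_all only: add_ac mult_Suc_right) simp_all
  show ?case
    unfolding prod.lessThan_Suc Suc.IH e by (simp add: mult_ac del: fact_Suc)
qed (simp del: fact_Suc)

lemma prod_fact_eq_prod:
  "(\<Prod>j<n. fact j / fact (2 * j)) * (\<Prod>j<n. fact (2 * m + 2 * j) / fact (2 * m + j))
     = (\<Prod>i<m. fact (2 * i + 1) * fact (2 * n + 2 * i) / (fact (n + 2 * i + 1) * fact (n + 2 * i))
         :: 'a::field_char_0)"
proof (induction m)
  case 0
  \<comment> \<open>For m = 0 the two products on the left are reciprocal, and the right one is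
    empty.\<close>
  show ?case
    by (simp flip: prod.distrib)
next
  case (Suc m)
  show ?case
    unfolding prod_fact_ratio_Suc prod.lessThan_Suc Suc.IH[symmetric] by (simp only: mult.assoc)
qed

lemma prod_lessThan_drop_0:
  fixes f :: "nat \<Rightarrow> 'a::comm_monoid_mult"
  assumes "f 0 = 1"
  shows "(\<Prod>j = 1..<n. f j) = (\<Prod>j<n. f j)"
proof (cases n)
  case (Suc k)
  then have "{..<n} = insert 0 {1..<n}"
    by auto
  with assms show ?thesis
    by simp
qed simp

theorem theorem4:
  fixes n m :: nat
  shows "det (mat n n (\<lambda>(i, j). (of_nat (int_binomial (i + j + m) (int i - int j + int m)) :: rat)))
           = (\<Prod>j = 1..<n. fact j / fact (2 * j)) * (\<Prod>j = 1..<n. fact (2 * m + 2 * j) / fact (2 * m + j))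
       \<and> (\<Prod>j = 1..<n. fact j / fact (2 * j)) * (\<Prod>j = 1..<n. fact (2 * m + 2 * j) / fact (2 * m + j))
           = det (mat m m (\<lambda>(i, j). catalan (n + i + j)))"
proof -
  \<comment> \<open>In both products the factor at j = 0 is 1, so starting at 0 changes
    nothing.\<close>
  have "(\<Prod>j = 1..<n. fact j / fact (2 * j) :: rat) = (\<Prod>j<n. fact j / fact (2 * j))"
    by (rule prod_lessThan_drop_0) simp
  moreover have "(\<Prod>j = 1..<n. fact (2 * m + 2 * j) / fact (2 * m + j) :: rat)
      = (\<Prod>j<n. fact (2 * m + 2 * j) / fact (2 * m + j))"
    by (rule prod_lessThan_drop_0) simp
  ultimately show ?thesis
    by (simp only: int_binomial_eq det_binomial det_catalan prod_fact_eq_prod)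
qed

end
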